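(* Let $T$ be a tree. Then $\mathsf{TS}_3(T)$ is acyclic if and only if $T$ is $\{2K_2+K_1, D_{2,4,2}\}$-free.
   Context: Graphs are finite, simple and undirected. For a graph $G$ and an integer $k\ge 2$, $\mathsf{TS}_k(G)$ is the graph whose nodes are all size-$k$ independent sets of $G$, two nodes $I,J$ being adjacent if there are vertices $u,v$ of $G$ with $I\setminus J=\{u\}$, $J\setminus I=\{v\}$ and $uv\in E(G)$. (A graph with no nodes counts as acyclic.) $+$ denotes disjoint union and $2K_2$ is the disjoint union of two copies of $K_2$. For integers $n,r,s\ge 1$, $D_{r,n,s}$ is the tree obtained from the path $P_n$ on $n$ vertices by attaching $r$ leaves to one end vertex and $s$ leaves to the other end vertex. A graph is $\mathcal{F}$-free if it contains no member of $\mathcal{F}$ as an induced subgraph (up to isomorphism). *)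

theory Defs
  imports
    "Graph_Theory.Digraph_Component"
    "Graph_Theory.Digraph_Isomorphism"
begin

text \<open>
  Finite simple undirected graphs are modelled by the locale \<^locale>\<open>pair_graph\<close>: an edge
  between \<open>u\<close> and \<open>v\<close> is represented by the two arcs \<open>(u, v)\<close> and \<open>(v, u)\<close>.
\<close>

text \<open>
  The library notion of a cycle counts \<open>(u, v), (v, u)\<close> as a cycle, so that
  \<^const>\<open>forest\<close> and \<^const>\<open>tree\<close> are not the undirected notions. In a simple undirected graph
  the cycles are the library cycles with at least three arcs.
\<close>

definition acyclic_graph :: "'a pair_pre_digraph \<Rightarrow> bool" where
  "acyclic_graph G \<longleftrightarrow> \<not> (\<exists>p. pre_digraph.cycle (with_proj G) p \<and> 3 \<le> length p)"

definition tree_graph :: "'a pair_pre_digraph \<Rightarrow> bool" where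
  "tree_graph G \<longleftrightarrow>
     pair_graph G \<and> Digraph_Component.connected (with_proj G) \<and> acyclic_graph G"

definition independent_set :: "'a pair_pre_digraph \<Rightarrow> 'a set \<Rightarrow> bool" where
  "independent_set G I \<longleftrightarrow> I \<subseteq> pverts G \<and> (\<forall>u\<in>I. \<forall>v\<in>I. (u, v) \<notin> parcs G)"

definition TS :: "nat \<Rightarrow> 'a pair_pre_digraph \<Rightarrow> 'a set pair_pre_digraph" where
  "TS k G =
     (let N = {I. independent_set G I \<and> finite I \<and> card I = k}
      in \<lparr> pverts = N,
           parcs = {(I, J). I \<in> N \<and> J \<in> N \<and>
             (\<exists>u v. I - J = {u} \<and> J - I = {v} \<and> (u, v) \<in> parcs G)} \<rparr>)"

definition complete_graph :: "nat \<Rightarrow> nat pair_pre_digraph" where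
  "complete_graph n =
     \<lparr> pverts = {..<n}, parcs = {(u, v). u < n \<and> v < n \<and> u \<noteq> v} \<rparr>"

text \<open>
  The disjoint union, kept on natural numbers so that all forbidden graphs have the same type:
  the vertices of \<open>G\<close> are renamed to even numbers, those of \<open>H\<close> to odd numbers.
\<close>

definition disjoint_union ::
  "nat pair_pre_digraph \<Rightarrow> nat pair_pre_digraph \<Rightarrow> nat pair_pre_digraph" where
  "disjoint_union G H =
     \<lparr> pverts = (\<lambda>v. 2 * v) ` pverts G \<union> (\<lambda>v. 2 * v + 1) ` pverts H,
       parcs = (\<lambda>(u, v). (2 * u, 2 * v)) ` parcs G
             \<union> (\<lambda>(u, v). (2 * u + 1, 2 * v + 1)) ` parcs H \<rparr>"

text \<open>
  The graph \<open>D\<^bsub>r,n,s\<^esub>\<close>, for \<open>n \<ge> 1\<close>. The path is \<open>0, \<dots>, n - 1\<close>; the \<open>r\<close> leaves at its end \<open>0\<close>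
  are \<open>n, \<dots>, n + r - 1\<close> and the \<open>s\<close> leaves at its end \<open>n - 1\<close> are \<open>n + r, \<dots>, n + r + s - 1\<close>.
\<close>

definition D_graph :: "nat \<Rightarrow> nat \<Rightarrow> nat \<Rightarrow> nat pair_pre_digraph" where
  "D_graph r n s =
     (let A = {(i, i + 1) | i. i + 1 < n}
            \<union> {(0, j) | j. n \<le> j \<and> j < n + r}
            \<union> {(n - 1, j) | j. n + r \<le> j \<and> j < n + r + s}
      in \<lparr> pverts = {..<n + r + s}, parcs = A \<union> A\<inverse> \<rparr>)"

definition contains_induced :: "'a pair_pre_digraph \<Rightarrow> 'b pair_pre_digraph \<Rightarrow> bool" where
  "contains_induced G H \<longleftrightarrow>
     (\<exists>K. induced_subgraph K (with_proj G) \<and> digraph_iso K (with_proj H))"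

definition free_of :: "'a pair_pre_digraph \<Rightarrow> 'b pair_pre_digraph set \<Rightarrow> bool" where
  "free_of G F \<longleftrightarrow> (\<forall>H\<in>F. \<not> contains_induced G H)"

lemma pair_graph_iff:
  "pair_graph G \<longleftrightarrow> finite (pverts G) \<and> parcs G \<subseteq> pverts G \<times> pverts G
     \<and> sym (parcs G) \<and> irrefl (parcs G)"
proof
  assume "pair_graph G"
  then interpret pair_graph G .
  show "finite (pverts G) \<and> parcs G \<subseteq> pverts G \<times> pverts G \<and> sym (parcs G) \<and> irrefl (parcs G)"
    using in_arcsD1 in_arcsD2 no_loops' arcs_symmetric pair_finite_verts
    by (fastforce simp: irrefl_def intro!: symI)
next
  assume "finite (pverts G) \<and> parcs G \<subseteq> pverts G \<times> pverts G
    \<and> sym (parcs G) \<and> irrefl (parcs G)"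
  then show "pair_graph G"
    by unfold_locales
      (auto simp: symmetric_def irrefl_def intro: finite_subset[of _ "pverts G \<times> pverts G"])
qed

lemma pair_graph_TS:
  assumes "pair_graph G"
  shows "pair_graph (TS k G)"
proof -
  have "finite (pverts G)" "sym (parcs G)"
    using assms by (auto simp: pair_graph_iff)
  moreover have "{I. independent_set G I \<and> finite I \<and> card I = k} \<subseteq> Pow (pverts G)"
    by (auto simp: independent_set_def)
  ultimately show ?thesis
    unfolding pair_graph_iff TS_def Let_def
    by (auto simp: irrefl_def intro!: symI intro: finite_subset dest: symD)
qed

lemma pair_graph_complete_graph: "pair_graph (complete_graph n)"
  by (auto simp: pair_graph_iff complete_graph_def irrefl_def intro!: symI)

lemma pair_graph_disjoint_union:
  assumes "pair_graph G" "pair_graph H"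
  shows "pair_graph (disjoint_union G H)"
proof -
  have "sym (parcs G)" "sym (parcs H)" "irrefl (parcs G)" "irrefl (parcs H)"
    using assms by (auto simp: pair_graph_iff)
  then have "sym (parcs (disjoint_union G H))" "irrefl (parcs (disjoint_union G H))"
    unfolding disjoint_union_def by (force simp: sym_def irrefl_def)+
  then show ?thesis
    using assms unfolding pair_graph_iff by (auto simp: disjoint_union_def)
qed

lemma pair_graph_D_graph:
  assumes "1 \<le> n"
  shows "pair_graph (D_graph r n s)"
  using assms unfolding pair_graph_iff D_graph_def Let_def
  by (auto simp: irrefl_def sym_def)

end

theory Submission
  imports Defs
begin

text \<open>
  Explicit cycles in \<open>TS\<^sub>3\<close> of the two forbidden graphs are carried over to \<open>T\<close> by induced
  embeddings. Conversely, if \<open>T\<close> is free of them, then at no node of a cycle of \<open>TS\<^sub>3(T)\<close> can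
  the two incident edges move different tokens: two slides \<open>u \<rightarrow> v\<close> and \<open>u' \<rightarrow> v'\<close> with the third
  token on \<open>w\<close> give, by \<open>2K\<^sub>2 + K\<^sub>1\<close>-freeness, first an edge \<open>v v'\<close>, then a path on six vertices
  ending in \<open>w\<close>, and following the cycle a few steps further exhibits \<open>D\<^bsub>2,4,2\<^esub>\<close>. So a single
  token moves along the whole cycle, and its positions form a cycle of \<open>T\<close>.
\<close>

section \<open>Cycles as vertex lists\<close>

definition vertex_cycle :: "'a rel \<Rightarrow> 'a list \<Rightarrow> bool" where
  "vertex_cycle E xs \<longleftrightarrow> 3 \<le> length xs \<and> distinct xs \<and>
     successively (\<lambda>u v. (u, v) \<in> E) xs \<and> (last xs, hd xs) \<in> E"

lemma pcas_imp_successively: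
  assumes "pcas u p v" "p \<noteq> []" "set p \<subseteq> E"
  shows "hd (map fst p) = u \<and> snd (last p) = v \<and>
    successively (\<lambda>u v. (u, v) \<in> E) (map fst p) \<and>
    pawalk_verts u p = map fst p @ [v]"
  using assms
proof (induction p arbitrary: u)
  case (Cons e p)
  show ?case
  proof (cases "p = []")
    case False
    with Cons have "hd (map fst p) = snd e \<and> snd (last p) = v \<and>
        successively (\<lambda>u v. (u, v) \<in> E) (map fst p) \<and> pawalk_verts (snd e) p = map fst p @ [v]"
      by auto
    with Cons.prems False show ?thesis
      by (cases p; cases e) auto
  qed (use Cons.prems in auto)
qed simp

lemma pcas_zip: "pcas x (zip (x # xs) (xs @ [y])) y"
  by (induction xs arbitrary: x) auto

lemma set_zip_successively:
  assumes "successively (\<lambda>u v. (u, v) \<in> E) (x # xs)" "(last (x # xs), y) \<in> E"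
  shows "set (zip (x # xs) (xs @ [y])) \<subseteq> E"
  using assms by (induction xs arbitrary: x) auto

text \<open>The first components of the arcs of a library cycle list its vertices once each.
  Conversely, zipping a vertex list with its rotation by one yields the arcs of a closed
  walk.\<close>

lemma acyclic_graph_iff:
  assumes "pair_graph G"
  shows "acyclic_graph G \<longleftrightarrow> (\<nexists>xs. vertex_cycle (parcs G) xs)"
proof -
  interpret pair_graph G by fact
  have "\<exists>xs. vertex_cycle (parcs G) xs" if "cycle p" "3 \<le> length p" for p
  proof -
    from that obtain u where u: "awalk u p u" "distinct (tl (awalk_verts u p))" "p \<noteq> []"
      by (auto simp: cycle_def)
    then have p: "hd (map fst p) = u \<and> snd (last p) = u \<and>
        successively (\<lambda>u v. (u, v) \<in> parcs G) (map fst p) \<and>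
        pawalk_verts u p = map fst p @ [u]"
      by (intro pcas_imp_successively) (auto simp: awalk_def)
    have "last p \<in> parcs G"
      using u by (auto simp: awalk_def)
    then have "(last (map fst p), hd (map fst p)) \<in> parcs G"
      using p u by (cases "last p") (auto simp: last_map)
    moreover have "distinct (map fst p)"
      using p u by (cases p) auto
    ultimately have "vertex_cycle (parcs G) (map fst p)"
      using p that unfolding vertex_cycle_def by auto
    then show ?thesis by blast
  qed
  moreover have "\<exists>p. cycle p \<and> 3 \<le> length p" if xs: "vertex_cycle (parcs G) xs" for xs
  proof -
    obtain x ys where xs_eq: "xs = x # ys"
      using xs by (cases xs) (auto simp: vertex_cycle_def)
    define p where "p = zip (x # ys) (ys @ [x])"
    have arcs: "set p \<subseteq> parcs G"
      unfolding p_def using xs by (intro set_zip_successively) (auto simp: vertex_cycle_def xs_eq)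
    have cas: "pcas x p x"
      unfolding p_def by (rule pcas_zip)
    have len: "length p = length xs"
      by (simp add: p_def xs_eq)
    then have "p \<noteq> []" by (auto simp: xs_eq)
    have "map fst p = xs"
      by (simp add: p_def xs_eq)
    then have "pawalk_verts x p = xs @ [x]"
      using pcas_imp_successively[OF cas \<open>p \<noteq> []\<close> arcs] by simp
    moreover have "x \<in> pverts G"
      using xs in_arcsD2 by (auto simp: vertex_cycle_def xs_eq)
    ultimately have "cycle p"
      using arcs cas \<open>p \<noteq> []\<close> xs unfolding cycle_def awalk_def
      by (auto simp: xs_eq vertex_cycle_def intro!: exI[of _ x])
    with len xs show ?thesis by (auto simp: vertex_cycle_def)
  qed
  ultimately show ?thesis
    unfolding acyclic_graph_def by blast
qed

text \<open>The cyclic successor and predecessor of \<open>x\<close> are distinct because the list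
  has at least three entries, so at least one of them differs from \<open>z\<close>.\<close>

lemma vertex_cycle_other_neighbour:
  assumes "vertex_cycle E xs" "sym E" "x \<in> set xs"
  obtains y where "y \<in> set xs" "y \<noteq> z" "(x, y) \<in> E"
proof -
  obtain i where i: "i < length xs" "x = xs ! i"
    using assms(3) by (metis in_set_conv_nth)
  have dist: "distinct xs" and len: "3 \<le> length xs"
    and suc: "\<And>k. Suc k < length xs \<Longrightarrow> (xs ! k, xs ! Suc k) \<in> E"
    using assms(1) by (auto simp: vertex_cycle_def successively_conv_nth)
  have "xs \<noteq> []"
    using len by auto
  then have close: "(xs ! (length xs - 1), xs ! 0) \<in> E"
    using assms(1) by (simp add: vertex_cycle_def last_conv_nth hd_conv_nth)
  define j where "j = (if Suc i = length xs then 0 else Suc i)"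
  define k where "k = (if i = 0 then length xs - 1 else i - 1)"
  have "j < length xs" "k < length xs" "j \<noteq> k"
    using i(1) len by (auto simp: j_def k_def)
  then have "xs ! j \<noteq> xs ! k" "{xs ! j, xs ! k} \<subseteq> set xs"
    using dist by (auto simp: nth_eq_iff_index_eq)
  moreover have "(x, xs ! j) \<in> E"
    using i suc[of i] close by (cases "length xs = Suc i") (auto simp: j_def)
  moreover have "(xs ! k, x) \<in> E"
    using i suc[of "i - 1"] close by (cases "i = 0") (auto simp: k_def)
  ultimately show ?thesis
    using that symD[OF assms(2)] by (metis insert_subset)
qed

section \<open>Induced subgraphs as embeddings\<close>

definition induced_embedding ::
  "('b \<Rightarrow> 'a) \<Rightarrow> 'b pair_pre_digraph \<Rightarrow> 'a pair_pre_digraph \<Rightarrow> bool" where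
  "induced_embedding f H G \<longleftrightarrow> inj_on f (pverts H) \<and> f ` pverts H \<subseteq> pverts G \<and>
     (\<forall>a\<in>pverts H. \<forall>b\<in>pverts H. (f a, f b) \<in> parcs G \<longleftrightarrow> (a, b) \<in> parcs H)"

text \<open>The library isomorphism runs from the subgraph \<open>K\<close> to \<open>H\<close>, so
  the embedding is its inverse. Conversely, \<open>K\<close> is the subgraph induced on the image of
  \<open>f\<close>, and arcs are renamed componentwise by the inverse of \<open>f\<close>.\<close>

lemma contains_induced_iff:
  assumes "pair_graph G" "pair_graph H"
  shows "contains_induced G H \<longleftrightarrow> (\<exists>f. induced_embedding f H G)"
proof
  interpret G: pair_graph G by fact
  interpret H: pair_graph H by fact
  assume "contains_induced G H"
  then obtain K h where K: "induced_subgraph K (with_proj G)"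
    and h: "pre_digraph.digraph_isomorphism K h" "with_proj H = app_iso h K"
    unfolding contains_induced_def digraph_iso_def by blast
  have proj: "tail K = fst" "head K = snd" and sub: "verts K \<subseteq> pverts G"
    and arcs: "arcs K = {e \<in> parcs G. fst e \<in> verts K \<and> snd e \<in> verts K}"
    using K by (auto simp: induced_subgraph_def subgraph_def compatible_def)
  have inj: "inj_on (iso_verts h) (verts K)"
    and ends: "iso_tail h = fst" "iso_head h = snd"
    and im: "pverts H = iso_verts h ` verts K" "parcs H = iso_arcs h ` arcs K"
    and hom: "\<And>a. a \<in> arcs K \<Longrightarrow> iso_arcs h a = (iso_verts h (fst a), iso_verts h (snd a))"
    using h unfolding pre_digraph.digraph_isomorphism_def app_iso_def with_proj_def
    by (auto simp: proj prod_eq_iff)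
  define f where "f = the_inv_into (verts K) (iso_verts h)"
  have f: "f (iso_verts h x) = x" if "x \<in> verts K" for x
    using the_inv_into_f_f[OF inj that] by (simp add: f_def)
  have "(x, y) \<in> parcs G \<longleftrightarrow> (iso_verts h x, iso_verts h y) \<in> parcs H"
    if "x \<in> verts K" "y \<in> verts K" for x y
  proof
    assume "(x, y) \<in> parcs G"
    then have "(x, y) \<in> arcs K" using that by (simp add: arcs)
    from imageI[OF this, of "iso_arcs h"] hom[OF this]
    show "(iso_verts h x, iso_verts h y) \<in> parcs H"
      by (simp add: im)
  next
    assume "(iso_verts h x, iso_verts h y) \<in> parcs H"
    then obtain e where "e \<in> arcs K" "iso_arcs h e = (iso_verts h x, iso_verts h y)"
      by (auto simp: im)
    with hom[of e] inj that have "e = (x, y)" "e \<in> parcs G"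
      by (auto simp: arcs inj_on_def prod_eq_iff)
    then show "(x, y) \<in> parcs G" by simp
  qed
  then have "induced_embedding f H G"
    using sub inj by (auto simp: induced_embedding_def im f inj_on_def)
  then show "\<exists>f. induced_embedding f H G" by blast
next
  interpret G: pair_graph G by fact
  interpret H: pair_graph H by fact
  assume "\<exists>f. induced_embedding f H G"
  then obtain f where inj: "inj_on f (pverts H)" and sub: "f ` pverts H \<subseteq> pverts G"
    and adj: "\<And>a b. a \<in> pverts H \<Longrightarrow> b \<in> pverts H \<Longrightarrow> (f a, f b) \<in> parcs G \<longleftrightarrow> (a, b) \<in> parcs H"
    by (auto simp: induced_embedding_def)
  define K where "K = with_proj \<lparr> pverts = f ` pverts H,
     parcs = {e \<in> parcs G. fst e \<in> f ` pverts H \<and> snd e \<in> f ` pverts H} \<rparr>"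
  have wfK: "wf_digraph K"
    by unfold_locales (auto simp: K_def)
  have K: "induced_subgraph K (with_proj G)"
    using sub wfK G.wf_digraph
    unfolding induced_subgraph_def subgraph_def compatible_def
    by (auto simp: K_def)
  define g where "g = the_inv_into (pverts H) f"
  have g: "g (f a) = a" if "a \<in> pverts H" for a
    using the_inv_into_f_f[OF inj that] by (simp add: g_def)
  define h where "h = \<lparr> iso_verts = g, iso_arcs = map_prod g g, iso_head = snd, iso_tail = fst \<rparr>"
  have "g ` f ` pverts H = pverts H"
    by (auto simp: g image_iff)
  moreover have "map_prod g g ` arcs K = parcs H"
  proof
    show "map_prod g g ` arcs K \<subseteq> parcs H"
      by (auto simp: K_def g adj)
    show "parcs H \<subseteq> map_prod g g ` arcs K"
    proof
      fix e assume e: "e \<in> parcs H"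
      obtain a b where ab: "e = (a, b)" by (cases e)
      then have V: "a \<in> pverts H" "b \<in> pverts H"
        using e H.in_arcsD1 H.in_arcsD2 by auto
      then have "(f a, f b) \<in> arcs K" "e = map_prod g g (f a, f b)"
        using e ab by (auto simp: K_def adj g)
      then show "e \<in> map_prod g g ` arcs K" by (rule rev_image_eqI)
    qed
  qed
  ultimately have "with_proj H = app_iso h K"
    by (simp add: app_iso_def h_def K_def with_proj_def)
  moreover have "pre_digraph.digraph_isomorphism K h"
    using wfK unfolding pre_digraph.digraph_isomorphism_def
    by (auto simp: h_def K_def inj_on_def g)
  ultimately show "contains_induced G H"
    using K unfolding contains_induced_def digraph_iso_def by blast
qed

section \<open>Chordless paths in acyclic graphs\<close>

text \<open>Consecutive entries are left unconstrained. The recursion lets the simplifier unfold an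
  explicit list into all its non-adjacencies.\<close>

fun chordless :: "'a rel \<Rightarrow> 'a list \<Rightarrow> bool" where
  "chordless E [] \<longleftrightarrow> True"
| "chordless E [x] \<longleftrightarrow> True"
| "chordless E (x # y # ys) \<longleftrightarrow>
     (\<forall>z\<in>set ys. (x, z) \<notin> E \<and> (z, x) \<notin> E) \<and> chordless E (y # ys)"

text \<open>A chord from \<open>x\<close> to a later \<open>z\<close> beyond the next vertex closes
  the segment between them into a cycle; the segment contains \<open>x\<close>, \<open>y\<close> and
  \<open>z\<close>, hence is long enough.\<close>

lemma acyclic_path_chordless:
  assumes "\<nexists>xs. vertex_cycle E xs" "sym E"
    and "successively (\<lambda>u v. (u, v) \<in> E) xs" "distinct xs"
  shows "chordless E xs"
  using assms(3,4)
proof (induction xs rule: induct_list012)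
  case (3 x y ys)
  have "(z, x) \<notin> E" if z: "z \<in> set ys" for z
  proof
    assume "(z, x) \<in> E"
    moreover obtain as bs where "ys = as @ z # bs"
      using split_list[OF z] by blast
    ultimately have "vertex_cycle E (x # y # as @ [z])"
      using 3(3,4) successively_append_iff[of _ "y # as @ [z]" bs]
      by (auto simp: vertex_cycle_def)
    then show False using assms(1) by blast
  qed
  then show ?case
    using 3 symD[OF assms(2)] by auto
qed auto

section \<open>Trees avoiding both forbidden graphs\<close>

text \<open>
  In an acyclic graph every copy of the tree \<open>D\<^bsub>2,4,2\<^esub>\<close> is induced, so it is excluded as an
  ordinary subgraph.
\<close>

locale forbidden_free_tree =
  fixes V :: "'a set" and E :: "'a rel"
  assumes edges_in: "E \<subseteq> V \<times> V" and sym_edges: "sym E" and irrefl_edges: "irrefl E"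
    and no_cycle: "\<nexists>xs. vertex_cycle E xs"
    and conn: "u \<in> V \<Longrightarrow> v \<in> V \<Longrightarrow> (u, v) \<in> E\<^sup>*"
    and no_2K2_K1: "\<lbrakk>(a, b) \<in> E; (c, d) \<in> E; e \<in> V;
      (a, c) \<notin> E; (a, d) \<notin> E; (b, c) \<notin> E; (b, d) \<notin> E;
      (e, a) \<notin> E; (e, b) \<notin> E; (e, c) \<notin> E; (e, d) \<notin> E\<rbrakk> \<Longrightarrow> False"
    and no_D_2_4_2: "\<lbrakk>distinct [p, q, r, s, a, b, c, d]; (p, q) \<in> E; (q, r) \<in> E; (r, s) \<in> E;
      (p, a) \<in> E; (p, b) \<in> E; (s, c) \<in> E; (s, d) \<in> E\<rbrakk> \<Longrightarrow> False"
begin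

abbreviation adj :: "'a \<Rightarrow> 'a \<Rightarrow> bool" (infix "\<sim>" 50) where
  "u \<sim> v \<equiv> (u, v) \<in> E"

lemma adj_sym: "u \<sim> v \<longleftrightarrow> v \<sim> u"
  using sym_edges by (meson symD)

lemma adj_irrefl [simp]: "\<not> u \<sim> u"
  using irrefl_edges by (simp add: irrefl_def)

lemma adj_in: "u \<sim> v \<Longrightarrow> u \<in> V" "u \<sim> v \<Longrightarrow> v \<in> V"
  using edges_in by auto

lemmas path_chordless = acyclic_path_chordless[OF no_cycle sym_edges]

text \<open>Connectivity reaches \<open>w\<close> from \<open>u\<close>. By induction along the
  walk, each vertex lies on the path, is adjacent to it, or is two steps from one of its
  ends.\<close>

lemma P4_remote_vertex:
  assumes P: "distinct [u, v, v', u']" "u \<sim> v" "v \<sim> v'" "v' \<sim> u'"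
    and w: "w \<in> V" "\<forall>p\<in>{u, v, v', u'}. w \<noteq> p \<and> \<not> w \<sim> p"
  obtains z where "w \<sim> z" "z \<notin> {u, v, v', u'}" "z \<sim> u \<or> z \<sim> u'"
proof -
  let ?P = "{u, v, v', u'}"
  have "x \<in> ?P \<or> (\<exists>p\<in>?P. x \<sim> p) \<or> (\<exists>z. x \<sim> z \<and> z \<notin> ?P \<and> (z \<sim> u \<or> z \<sim> u'))"
    if "(u, x) \<in> E\<^sup>*" for x
    using that
  proof (induction rule: rtrancl_induct)
    case (step x y)
    have yx: "y \<sim> x" using step.hyps(2) adj_sym by blast
    have y: "y \<in> V" using adj_in yx by blast
    have "\<exists>z. y \<sim> z \<and> z \<notin> ?P \<and> (z \<sim> u \<or> z \<sim> u')" if far: "y \<notin> ?P" "\<forall>p\<in>?P. \<not> y \<sim> p"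
    proof -
      have x: "x \<notin> ?P" using far yx by blast
      note nonadj = far(2)[simplified] adj_sym
      consider "x \<sim> u \<or> x \<sim> u'" | "x \<sim> v" | "x \<sim> v'"
        | z where "x \<sim> z" "z \<notin> ?P" "z \<sim> u" | z where "x \<sim> z" "z \<notin> ?P" "z \<sim> u'"
        using step.IH x by auto
      then show ?thesis
      proof cases
        case 1
        then show ?thesis using yx x by blast
      next
        case 2
        have "chordless E [x, v, v', u']" "chordless E [x, v, u]" "chordless E [u, v, v', u']"
          using 2 P x by (intro path_chordless; auto simp: adj_sym)+
        then have False
          using no_2K2_K1[of y x v' u' u] yx P far adj_in by (auto simp: adj_sym)
        then show ?thesis ..
      next
        case 3
        have "chordless E [x, v', v, u]" "chordless E [x, v', u']" "chordless E [u, v, v', u']"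
          using 3 P x by (intro path_chordless; auto simp: adj_sym)+
        then have False
          using no_2K2_K1[of y x u v u'] yx P far adj_in by (auto simp: adj_sym)
        then show ?thesis ..
      next
        case 4
        have "chordless E [x, z, u, v, v', u']"
          using 4 P x by (intro path_chordless) (auto simp: adj_sym)
        then have False
          using no_2K2_K1[of y x u v u'] yx P far adj_in by (auto simp: adj_sym)
        then show ?thesis ..
      next
        case 5
        have "chordless E [x, z, u', v', v, u]"
          using 5 P x by (intro path_chordless) (auto simp: adj_sym)
        then have False
          using no_2K2_K1[of y x u' v' u] yx P far adj_in by (auto simp: adj_sym)
        then show ?thesis ..
      qed
    qed
    then show ?case by blast
  qed simp
  moreover have "(u, w) \<in> E\<^sup>*"
    using w(1) P(2) adj_in conn by blast
  ultimately show ?thesis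
    using w(2) that by blast
qed
end

section \<open>Local analysis of cycles of the token sliding graph\<close>

text \<open>
  \<open>S\<close> plays the role of the set of nodes of a cycle of the token sliding graph: every node has
  a neighbour in \<open>S\<close> other than a prescribed one.
\<close>

locale token_cycle = forbidden_free_tree +
  fixes S :: "'a set set"
  assumes indep: "I \<in> S \<Longrightarrow> I \<subseteq> V \<and> card I = 3 \<and> (\<forall>u\<in>I. \<forall>v\<in>I. (u, v) \<notin> E)"
    and move: "I \<in> S \<Longrightarrow> \<exists>K\<in>S. K \<noteq> J \<and> (\<exists>u v. I - K = {u} \<and> K - I = {v} \<and> (u, v) \<in> E)"
begin

lemma indep3:
  assumes "{a, b, c} \<in> S"
  shows "a \<noteq> b" "a \<noteq> c" "b \<noteq> c" "a \<in> V" "b \<in> V" "c \<in> V"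
    "\<not> a \<sim> b" "\<not> a \<sim> c" "\<not> b \<sim> a" "\<not> b \<sim> c" "\<not> c \<sim> a" "\<not> c \<sim> b"
  using indep[OF assms] by (auto simp: card_insert_if split: if_splits)

text \<open>Splits the next slide by the token that moves; \<open>J\<close> will be the node the
  walk has just come from, so that backtracking is excluded.\<close>

lemma move3:
  assumes "{a, b, c} \<in> S"
  obtains t where "a \<sim> t" "{t, b, c} \<in> S" "{t, b, c} \<noteq> J"
  | t where "b \<sim> t" "{a, t, c} \<in> S" "{a, t, c} \<noteq> J"
  | t where "c \<sim> t" "{a, b, t} \<in> S" "{a, b, t} \<noteq> J"
proof -
  obtain K u v where K: "K \<in> S" "K \<noteq> J" "{a, b, c} - K = {u}" "K - {a, b, c} = {v}" "u \<sim> v"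
    using move[OF assms, of J] by (elim bexE conjE exE)
  note dist = indep3(1-3)[OF assms]
  have "K = ({a, b, c} - ({a, b, c} - K)) \<union> (K - {a, b, c})" by auto
  then have "K = insert v ({a, b, c} - {u})" unfolding K(3,4) by simp
  moreover have "u \<in> {a, b, c}"
    using K(3) by (metis Diff_iff singletonI)
  ultimately consider "u = a" "K = {v, b, c}" | "u = b" "K = {a, v, c}" | "u = c" "K = {a, b, v}"
    using dist by (auto simp: insert_commute)
  then show ?thesis
    using that K(1,2,5) by cases auto
qed

text \<open>
  Around a node \<open>{u, u', w}\<close> of an induced path \<open>u, v, v', u', z, w\<close> with both slides \<open>u\<close> to
  \<open>v\<close> and \<open>u'\<close> to \<open>v'\<close> available, continuing the walk in both directions forces a second leaf
  at \<open>v\<close> and at \<open>z\<close>.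
\<close>

lemma no_two_slides_on_P6:
  assumes P: "distinct [u, v, v', u', z, w]" "u \<sim> v" "v \<sim> v'" "v' \<sim> u'" "u' \<sim> z" "z \<sim> w"
    and S: "{v, u', w} \<in> S" "{u, v', w} \<in> S"
  shows False
proof -
  have P_sym: "v \<sim> u" "v' \<sim> v" "u' \<sim> v'" "z \<sim> u'" "w \<sim> z"
    using P adj_sym by blast+
  note in_V = P(2-6)[THEN adj_in(1)] P(2-6)[THEN adj_in(2)]
  have chord: "chordless E [u, v, v', u', z, w]"
    using P by (intro path_chordless) auto
  \<comment> \<open>This and the next two facts show that only \<open>v\<close> and \<open>z\<close>
    can have neighbours off the path: a new neighbour of \<open>u\<close>, \<open>w\<close>,
    \<open>v'\<close> or \<open>u'\<close> completes a 2K2+K1.\<close>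
  have no_end_u: False if "u \<sim> s" "s \<notin> {v, v', u', z, w}" for s
  proof -
    have "chordless E [s, u, v, v', u', z, w]"
      using that P by (intro path_chordless) (auto simp: adj_sym)
    then show False
      using no_2K2_K1[of s u z w v'] chord that P in_V by (auto simp: adj_sym)
  qed
  have no_end_w: False if "w \<sim> s" "s \<notin> {u, v, v', u', z}" for s
  proof -
    have "chordless E [u, v, v', u', z, w, s]"
      using that P by (intro path_chordless) auto
    then show False
      using no_2K2_K1[of s w u' v' u] chord that P in_V by (auto simp: adj_sym)
  qed
  have no_branch: False if s: "v' \<sim> s \<or> u' \<sim> s" "s \<notin> {u, v, v', u', z, w}" for s
  proof -
    have "(\<not> s \<sim> u \<and> \<not> s \<sim> v) \<and> (\<not> s \<sim> z \<and> \<not> s \<sim> w)"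
      using s(1)
    proof
      assume "v' \<sim> s"
      then have "chordless E [u, v, v', s]" "chordless E [s, v', u', z, w]"
        using s P by (intro path_chordless; auto simp: adj_sym)+
      then show ?thesis by (auto simp: adj_sym)
    next
      assume "u' \<sim> s"
      then have "chordless E [u, v, v', u', s]" "chordless E [s, u', z, w]"
        using s P by (intro path_chordless; auto simp: adj_sym)+
      then show ?thesis by (auto simp: adj_sym)
    qed
    moreover have "s \<in> V" using s(1) adj_in by blast
    ultimately show False
      using no_2K2_K1[of u v z w s] chord P by auto
  qed
  \<comment> \<open>At \<open>{v, u', w}\<close> the path neighbours of \<open>u'\<close> and
    \<open>w\<close> are blocked by other tokens, and new ones are excluded above. So the token on
    \<open>v\<close> must move, and neither back to \<open>u\<close> nor to \<open>v'\<close>, which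
    is adjacent to \<open>u'\<close>.\<close>
  obtain t where t: "v \<sim> t" "t \<notin> {u, v, v', u', z, w}"
  proof (cases rule: move3[OF S(1), of "{u, u', w}"])
    case (1 t)
    note t = indep3[OF 1(2)]
    have "t \<noteq> v'" "t \<noteq> z" "t \<noteq> v" "t \<noteq> u"
      using t 1 P P_sym by auto
    with t show ?thesis using that 1 by auto
  next
    case (2 t)
    note t = indep3[OF 2(2)]
    have "t \<noteq> v'" "t \<noteq> z" "t \<noteq> u'" "t \<noteq> u"
      using t 2 P P_sym by auto
    with t show ?thesis using no_branch[of t] 2 by auto
  next
    case (3 t)
    note t = indep3[OF 3(2)]
    have "t \<noteq> v'" "t \<noteq> z" "t \<noteq> w" "t \<noteq> u"
      using t 3 P P_sym by auto
    with t show ?thesis using no_end_w[of t] 3 by auto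
  qed
  \<comment> \<open>At \<open>{u, v', w}\<close> the only slide that does not return to
    \<open>{u, u', w}\<close> takes \<open>w\<close> to \<open>z\<close>.\<close>
  have S': "{u, v', z} \<in> S"
  proof (cases rule: move3[OF S(2), of "{u, u', w}"])
    case (1 s)
    note s = indep3[OF 1(2)]
    have "s \<noteq> v" "s \<noteq> u'" "s \<noteq> z"
      using s 1 P P_sym by auto
    with s show ?thesis using no_end_u[of s] 1 by auto
  next
    case (2 s)
    note s = indep3[OF 2(2)]
    have "s \<noteq> v" "s \<noteq> z" "s \<noteq> v'" "s \<noteq> u'"
      using s 2 P P_sym by auto
    with s show ?thesis using no_branch[of s] 2 by auto
  next
    case (3 s)
    note s = indep3[OF 3(2)]
    have "s \<noteq> v" "s \<noteq> u'"
      using s 3 P P_sym by auto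
    with s show ?thesis using no_end_w[of s] 3 by auto
  qed
  \<comment> \<open>Leaving \<open>{u, v', z}\<close> without going back to \<open>w\<close> is only
    possible from \<open>z\<close> to a new vertex \<open>s\<close>. Then the path
    \<open>v, v', u', z\<close> with leaves \<open>u, t\<close> at \<open>v\<close> and
    \<open>w, s\<close> at \<open>z\<close> is the second forbidden graph.\<close>
  show False
  proof (cases rule: move3[OF S', of "{u, v', w}"])
    case (1 s)
    note s = indep3[OF 1(2)]
    have "s \<noteq> v" "s \<noteq> u'" "s \<noteq> w"
      using s 1 P P_sym by auto
    with s show ?thesis using no_end_u[of s] 1 by auto
  next
    case (2 s)
    note s = indep3[OF 2(2)]
    have "s \<noteq> v" "s \<noteq> w" "s \<noteq> v'" "s \<noteq> u'"
      using s 2 P P_sym by auto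
    with s show ?thesis using no_branch[of s] 2 by auto
  next
    case (3 s)
    note s = indep3[OF 3(2)]
    have "s \<noteq> v" "s \<noteq> u'" "s \<noteq> w" "s \<noteq> z"
      using s 3 P P_sym by auto
    moreover have "s \<noteq> t"
    proof
      \<comment> \<open>If \<open>s = t\<close>, the edge \<open>z t\<close> would be a chord of
        this path.\<close>
      have "chordless E [t, v, v', u', z]"
        using t P by (intro path_chordless) (auto simp: adj_sym)
      moreover assume "s = t"
      ultimately show False using 3 by auto
    qed
    ultimately show False
      using no_D_2_4_2[of v v' u' z u t w s] s t 3 P P_sym by auto
  qed
qed

text \<open>If different tokens moved, the third token \<open>w\<close> would be remote from the
  path \<open>u, v, v', u'\<close>. It then extends this path beyond one end to a path on six
  vertices, which \<open>no_two_slides_on_P6\<close> rules out.\<close>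

lemma same_token_moves:
  assumes "I \<in> S" "J \<in> S" "J' \<in> S"
    and u: "I - J = {u}" "J - I = {v}" "u \<sim> v"
    and u': "I - J' = {u'}" "J' - I = {v'}" "u' \<sim> v'"
  shows "u = u'"
proof (rule ccontr)
  assume neq: "u \<noteq> u'"
  have "{u, u'} \<subseteq> I"
    using u(1) u'(1) by auto
  then have "card (I - {u, u'}) = 1"
    using indep[OF assms(1)] neq u(1) u'(1) card_Diff_subset[of "{u, u'}" I] by auto
  then obtain w where w: "I - {u, u'} = {w}"
    by (auto simp: card_1_singleton_iff)
  then have I_eq: "I = {u, u', w}"
    using u(1) u'(1) by auto
  have "J = (I - (I - J)) \<union> (J - I)" "J' = (I - (I - J')) \<union> (J' - I)"
    by auto
  then have "J = {v, u', w}" "J' = {u, v', w}"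
    unfolding u(1,2) u'(1,2) using neq w I_eq by auto
  then have S: "{u, u', w} \<in> S" "{v, u', w} \<in> S" "{u, v', w} \<in> S"
    using assms(1-3) I_eq by auto
  note I = indep3[OF S(1)] and J = indep3[OF S(2)] and J' = indep3[OF S(3)]
  \<comment> \<open>Otherwise the edges \<open>u v\<close> and \<open>u' v'\<close> together with
    \<open>w\<close> form 2K2+K1.\<close>
  have vv': "v \<sim> v'"
  proof (rule ccontr)
    assume "\<not> v \<sim> v'"
    then show False
      using no_2K2_K1[of u v u' v' w] I J J' u(3) u'(3) by blast
  qed
  have dist: "distinct [u, v, v', u']"
    using I J J' u(3) u'(3) vv' by auto
  have far: "\<forall>p\<in>{u, v, v', u'}. w \<noteq> p \<and> \<not> w \<sim> p"
    using I J J' by auto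
  have "v' \<sim> u'" "v \<sim> u" "v' \<sim> v"
    using u' u(3) vv' adj_sym by blast+
  then obtain z where z: "w \<sim> z" "z \<notin> {u, v, v', u'}" "z \<sim> u \<or> z \<sim> u'"
    using P4_remote_vertex[of u v v' u' w] dist u(3) vv' I far by blast
  then have "z \<noteq> w" "w \<notin> {u, v, v', u'}" using far z(1) by auto
  from z(3) show False
  proof
    assume "z \<sim> u'"
    then show False
      using no_two_slides_on_P6[of u v v' u' z w] z dist S u u' vv' \<open>z \<noteq> w\<close> \<open>w \<notin> _\<close> \<open>v' \<sim> u'\<close>
      by (auto simp: adj_sym)
  next
    \<comment> \<open>The mirror image: the path is read backwards and the two slides swap
      roles.\<close>
    assume "z \<sim> u"
    then show False
      using no_two_slides_on_P6[of u' v' v u z w] z dist S u u' \<open>v' \<sim> v\<close> \<open>z \<noteq> w\<close> \<open>w \<notin> _\<close> \<open>v \<sim> u\<close>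
      by (auto simp: adj_sym insert_commute)
  qed
qed

end

section \<open>Projecting a cycle to the positions of its moving token\<close>

text \<open>By \<open>same\<close>, both edges at a node keep the same tokens in place, so the
  intersection \<open>A\<close> of consecutive nodes is constant along the cycle. Every node is
  \<open>A\<close> plus one token, and these tokens trace a cycle of \<open>E\<close>.\<close>

lemma vertex_cycle_single_token:
  assumes cyc: "vertex_cycle F xs" and F: "sym F"
    and slide: "\<And>I J. (I, J) \<in> F \<Longrightarrow> \<exists>u v. I - J = {u} \<and> J - I = {v} \<and> (u, v) \<in> E"
    and same: "\<And>I J J'. \<lbrakk>I \<in> set xs; J \<in> set xs; J' \<in> set xs; (I, J) \<in> F; (I, J') \<in> F\<rbrakk>
      \<Longrightarrow> I - J = I - J'"
  shows "\<exists>ys. vertex_cycle E ys"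
proof -
  have len: "3 \<le> length xs" and dist: "distinct xs" and close: "(last xs, hd xs) \<in> F"
    and suc: "\<And>i. Suc i < length xs \<Longrightarrow> (xs ! i, xs ! Suc i) \<in> F"
    using cyc by (auto simp: vertex_cycle_def successively_conv_nth)
  define A where "A = xs ! 0 \<inter> xs ! 1"
  have A: "xs ! i \<inter> xs ! Suc i = A" if "Suc i < length xs" for i
    using that
  proof (induction i)
    case (Suc i)
    have "(xs ! Suc i, xs ! i) \<in> F" "(xs ! Suc i, xs ! Suc (Suc i)) \<in> F"
      using symD[OF F suc[of i]] suc[of "Suc i"] Suc.prems by simp_all
    then have "xs ! Suc i - xs ! i = xs ! Suc i - xs ! Suc (Suc i)"
      using Suc.prems by (intro same) simp_all
    then have "xs ! Suc i \<inter> xs ! Suc (Suc i) = xs ! i \<inter> xs ! Suc i"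
      using Diff_Diff_Int[of "xs ! Suc i"] by (metis Int_commute)
    with Suc show ?case by simp
  qed (simp add: A_def)
  have ex: "\<exists>t. t \<notin> A \<and> insert t A = I" if "I \<in> set xs" for I
  proof -
    obtain i where i: "i < length xs" "I = xs ! i"
      using \<open>I \<in> set xs\<close> by (auto simp: in_set_conv_nth)
    have "\<exists>J. (I, J) \<in> F \<and> I \<inter> J = A"
    proof (cases "Suc i < length xs")
      case True
      then show ?thesis
        using i suc[of i] A[of i] by (intro exI[of _ "xs ! Suc i"]) simp
    next
      \<comment> \<open>The last node has no successor in the list, so its predecessor is
        used.\<close>
      case False
      then obtain j where "i = Suc j" using i len by (cases i) auto
      then show ?thesis
        using i symD[OF F suc[of j]] A[of j]
        by (intro exI[of _ "xs ! j"]) (simp add: Int_commute)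
    qed
    then obtain J where J: "(I, J) \<in> F" "I \<inter> J = A" by blast
    obtain t where t: "I - J = {t}"
      using slide[OF J(1)] by auto
    have "insert t A = (I - J) \<union> (I \<inter> J)"
      unfolding t J(2) by simp
    then have "insert t A = I" by (simp add: Un_Diff_Int)
    moreover have "t \<in> I - J" unfolding t by simp
    then have "t \<notin> A" unfolding J(2)[symmetric] by simp
    ultimately show ?thesis by blast
  qed
  define t where "t I = (SOME t. t \<notin> A \<and> insert t A = I)" for I
  have t: "t I \<notin> A" "insert (t I) A = I" if "I \<in> set xs" for I
    using someI_ex[OF ex[OF that]] unfolding t_def[symmetric] by simp_all
  have adj: "(t I, t J) \<in> E" if arc: "(I, J) \<in> F" and IJ: "I \<in> set xs" "J \<in> set xs" for I J
  proof -
    obtain u v where uv: "I - J = {u}" "J - I = {v}" "(u, v) \<in> E"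
      using slide[OF arc] by auto
    have "u \<in> insert (t I) A" "v \<in> insert (t J) A"
      unfolding t(2)[OF IJ(1)] t(2)[OF IJ(2)] using uv by auto
    moreover have "A \<subseteq> I" "A \<subseteq> J"
      using subset_insertI[of A "t I"] subset_insertI[of A "t J"]
      unfolding t(2)[OF IJ(1)] t(2)[OF IJ(2)] by simp_all
    moreover have "u \<notin> J" "v \<notin> I" using uv by auto
    ultimately have "u = t I" "v = t J" by auto
    with uv show ?thesis by simp
  qed
  have "inj_on t (set xs)"
  proof (rule inj_onI)
    fix I J assume IJ: "I \<in> set xs" "J \<in> set xs" and eq: "t I = t J"
    show "I = J" using t(2)[OF IJ(1)] t(2)[OF IJ(2)] unfolding eq by simp
  qed
  moreover have "(t (last xs), t (hd xs)) \<in> E"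
    using len by (intro adj close last_in_set hd_in_set) auto
  moreover have "successively (\<lambda>I J. (t I, t J) \<in> E) xs"
    unfolding successively_conv_nth by (intro allI impI adj suc) simp_all
  moreover have "xs \<noteq> []" using len by auto
  ultimately have "vertex_cycle E (map t xs)"
    using len dist
    by (auto simp: vertex_cycle_def distinct_map successively_map last_map hd_map)
  then show ?thesis ..
qed

section \<open>Token sliding under induced embeddings\<close>

lemma TS_slideD:
  assumes "(I, J) \<in> parcs (TS k G)"
  shows "\<exists>u v. I - J = {u} \<and> J - I = {v} \<and> (u, v) \<in> parcs G"
  using assms by (auto simp: TS_def)

text \<open>There is one rule for each position of the moving token, so that \<open>intro\<close>
  applies to explicitly written nodes.\<close>

lemma TS_slide3I:
  assumes "independent_set G {a, b, c}" "independent_set G {d, b, c}"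
    and "distinct [a, b, c]" "distinct [d, b, c]" "a \<noteq> d" "(a, d) \<in> parcs G"
  shows "({a, b, c}, {d, b, c}) \<in> parcs (TS 3 G)"
    and "({b, a, c}, {b, d, c}) \<in> parcs (TS 3 G)"
    and "({b, c, a}, {b, c, d}) \<in> parcs (TS 3 G)"
proof -
  have "{a, b, c} - {d, b, c} = {a}" "{d, b, c} - {a, b, c} = {d}"
    using assms by auto
  then have "({a, b, c}, {d, b, c}) \<in> parcs (TS 3 G)"
    using assms by (auto simp: TS_def)
  then show "({a, b, c}, {d, b, c}) \<in> parcs (TS 3 G)"
    "({b, a, c}, {b, d, c}) \<in> parcs (TS 3 G)" "({b, c, a}, {b, c, d}) \<in> parcs (TS 3 G)"
    by (simp_all add: insert_commute)
qed

text \<open>Reflecting adjacency keeps independent sets independent; injectivity keeps their size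
  and their differences.\<close>

lemma induced_embedding_TS_arc:
  assumes f: "induced_embedding f H G" and arc: "(I, J) \<in> parcs (TS k H)"
  shows "(f ` I, f ` J) \<in> parcs (TS k G)"
proof -
  have inj: "inj_on f (pverts H)" and sub: "f ` pverts H \<subseteq> pverts G"
    and adj: "\<And>a b. a \<in> pverts H \<Longrightarrow> b \<in> pverts H \<Longrightarrow> (f a, f b) \<in> parcs G \<longleftrightarrow> (a, b) \<in> parcs H"
    using f by (auto simp: induced_embedding_def)
  have node: "independent_set G (f ` K) \<and> finite (f ` K) \<and> card (f ` K) = k"
    if "independent_set H K" "finite K" "card K = k" for K
  proof -
    have K: "K \<subseteq> pverts H" and nonadj: "\<And>a b. a \<in> K \<Longrightarrow> b \<in> K \<Longrightarrow> (a, b) \<notin> parcs H"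
      using that(1) by (auto simp: independent_set_def)
    have "(f a, f b) \<notin> parcs G" if "a \<in> K" "b \<in> K" for a b
      using K adj[of a b] nonadj that by auto
    then have "independent_set G (f ` K)"
      using image_mono[OF K, of f] sub by (auto simp: independent_set_def)
    moreover have "inj_on f K"
      using inj K by (rule inj_on_subset)
    ultimately show ?thesis using that by (simp add: card_image)
  qed
  obtain u v where uv: "I - J = {u}" "J - I = {v}" "(u, v) \<in> parcs H"
    using TS_slideD[OF arc] by blast
  have IJ: "I \<subseteq> pverts H" "J \<subseteq> pverts H"
    using arc by (auto simp: TS_def independent_set_def)
  then have "f ` (I - J) = f ` I - f ` J" "f ` (J - I) = f ` J - f ` I"
    by (intro inj_on_image_set_diff[OF inj]; auto)+
  then have "f ` I - f ` J = {f u}" "f ` J - f ` I = {f v}"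
    unfolding uv by simp_all
  moreover have "(f u, f v) \<in> parcs G"
  proof -
    have "u \<in> I" "v \<in> J" using uv by auto
    then show ?thesis using uv(3) IJ adj[of u v] by auto
  qed
  moreover have "independent_set G (f ` I) \<and> finite (f ` I) \<and> card (f ` I) = k"
    "independent_set G (f ` J) \<and> finite (f ` J) \<and> card (f ` J) = k"
    using arc by (intro node; simp add: TS_def)+
  ultimately show ?thesis
    by (simp add: TS_def)
qed

lemma vertex_cycle_TS_induced_embedding:
  assumes f: "induced_embedding f H G" and H: "pair_graph H"
    and xs: "vertex_cycle (parcs (TS k H)) xs"
  shows "vertex_cycle (parcs (TS k G)) (map (image f) xs)"
proof -
  have "sym (parcs (TS k H))"
    using pair_graph_TS[OF H] by (auto simp: pair_graph_iff)
  \<comment> \<open>Every node of the cycle is the tail of some arc, hence a genuine node of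
    \<open>TS k H\<close>. This makes \<open>image f\<close> injective on the cycle.\<close>
  then have "I \<subseteq> pverts H" if "I \<in> set xs" for I
  proof (rule vertex_cycle_other_neighbour[OF xs _ that])
    fix J assume "(I, J) \<in> parcs (TS k H)"
    then show ?thesis by (simp add: TS_def independent_set_def)
  qed
  then have "set xs \<subseteq> Pow (pverts H)" by auto
  moreover have "inj_on (image f) (Pow (pverts H))"
    using f by (simp add: induced_embedding_def inj_on_image_Pow)
  ultimately have "inj_on (image f) (set xs)"
    by (rule inj_on_subset[rotated])
  moreover have "successively (\<lambda>I J. (f ` I, f ` J) \<in> parcs (TS k G)) xs"
    using xs induced_embedding_TS_arc[OF f]
    unfolding vertex_cycle_def by (blast intro: successively_mono)
  moreover have "xs \<noteq> []" using xs by (auto simp: vertex_cycle_def)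
  ultimately show ?thesis
    using xs induced_embedding_TS_arc[OF f]
    by (auto simp: vertex_cycle_def distinct_map successively_map last_map hd_map)
qed

section \<open>The two forbidden graphs\<close>

abbreviation "two_K2_K1 \<equiv>
  disjoint_union (disjoint_union (complete_graph 2) (complete_graph 2)) (complete_graph 1)"

text \<open>The nested even and odd renamings send a vertex \<open>v\<close> to \<open>4 * v\<close>
  in the first edge, to \<open>2 * (2 * v + 1)\<close> in the second, and the isolated vertex to
  \<open>1\<close>.\<close>

lemma two_K2_K1_simps:
  "pverts two_K2_K1 = {0, 4, 2, 6, 1}"
  "parcs two_K2_K1 = {(0, 4), (4, 0), (2, 6), (6, 2)}"
proof -
  have "pverts (complete_graph 2) = {0, 1}" "parcs (complete_graph 2) = {(0, 1), (1, 0)}"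
    "pverts (complete_graph 1) = {0}" "parcs (complete_graph 1) = {}"
    by (auto simp: complete_graph_def)
  then show "pverts two_K2_K1 = {0, 4, 2, 6, 1}"
    "parcs two_K2_K1 = {(0, 4), (4, 0), (2, 6), (6, 2)}"
    by (auto simp: disjoint_union_def)
qed

lemma D_2_4_2_simps:
  "pverts (D_graph 2 4 2) = {0, 1, 2, 3, 4, 5, 6, 7}"
  "parcs (D_graph 2 4 2) = {(0, 1), (1, 2), (2, 3), (0, 4), (0, 5), (3, 6), (3, 7),
     (1, 0), (2, 1), (3, 2), (4, 0), (5, 0), (6, 3), (7, 3)}"
proof -
  have "{(i, i + 1) | i. i + 1 < (4 :: nat)} = {(0, 1), (1, 2), (2, 3)}"
    "{(0 :: nat, j) | j. 4 \<le> j \<and> j < (4 + 2 :: nat)} = {(0, 4), (0, 5)}"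
    "{(4 - 1 :: nat, j) | j. 4 + 2 \<le> j \<and> j < (4 + 2 + 2 :: nat)} = {(3, 6), (3, 7)}"
    by auto
  then show "parcs (D_graph 2 4 2) = {(0, 1), (1, 2), (2, 3), (0, 4), (0, 5), (3, 6), (3, 7),
     (1, 0), (2, 1), (3, 2), (4, 0), (5, 0), (6, 3), (7, 3)}"
    unfolding D_graph_def Let_def by auto
  show "pverts (D_graph 2 4 2) = {0, 1, 2, 3, 4, 5, 6, 7}"
    by (auto simp: D_graph_def Let_def)
qed

text \<open>The token on \<open>1\<close> rests while the other two take turns sliding along their
  own edges.\<close>

lemma vertex_cycle_TS_two_K2_K1:
  "vertex_cycle (parcs (TS 3 two_K2_K1)) [{0, 2, 1}, {4, 2, 1}, {4, 6, 1}, {0, 6, 1}]"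
proof -
  have "distinct [{0, 2, 1}, {4, 2, 1}, {4, 6, 1}, {0, 6, 1 :: nat}]"
    by (simp add: set_eq_subset)
  then show ?thesis
    unfolding vertex_cycle_def
    by (simp only: successively.simps list.sel last.simps list.simps if_True if_False simp_thms,
        intro conjI TS_slide3I) (simp_all add: independent_set_def two_K2_K1_simps del: One_nat_def)
qed

text \<open>With the middle token on \<open>2\<close>, the left token can change leaf through
  \<open>0\<close>; with it on \<open>1\<close>, the right token can change leaf through
  \<open>3\<close>. Alternating these changes returns to the start after twelve slides.\<close>

lemma vertex_cycle_TS_D_2_4_2:
  "vertex_cycle (parcs (TS 3 (D_graph 2 4 2)))
     [{4, 2, 6}, {0, 2, 6}, {5, 2, 6}, {5, 1, 6}, {5, 1, 3}, {5, 1, 7},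
      {5, 2, 7}, {0, 2, 7}, {4, 2, 7}, {4, 1, 7}, {4, 1, 3}, {4, 1, 6}]"
  (is "vertex_cycle _ ?xs")
proof -
  have "distinct ?xs"
    by (simp add: set_eq_subset)
  then show ?thesis
    unfolding vertex_cycle_def
    by (simp only: successively.simps list.sel last.simps list.simps if_True if_False simp_thms,
        intro conjI TS_slide3I) (simp_all add: independent_set_def D_2_4_2_simps del: One_nat_def)
qed

lemma induced_embedding_two_K2_K1:
  assumes "pair_graph G" "(a, b) \<in> parcs G" "(c, d) \<in> parcs G" "e \<in> pverts G"
    and "\<forall>(u, v) \<in> {(a, c), (a, d), (b, c), (b, d), (e, a), (e, b), (e, c), (e, d)}.
      (u, v) \<notin> parcs G"
  shows "\<exists>f. induced_embedding f two_K2_K1 G"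
proof -
  have "(v, u) \<in> parcs G" if "(u, v) \<in> parcs G" for u v
    using assms(1) that by (auto simp: pair_graph_iff dest: symD)
  moreover have "(u, u) \<notin> parcs G" "(u, v) \<in> parcs G \<Longrightarrow> u \<in> pverts G \<and> v \<in> pverts G" for u v
    using assms(1) by (auto simp: pair_graph_iff irrefl_def)
  \<comment> \<open>The list is indexed by the vertex numbers; \<open>3\<close> and \<open>5\<close>
    are not vertices, hence the \<open>undefined\<close> entries.\<close>
  ultimately have "induced_embedding ((!) [a, e, c, undefined, b, undefined, d]) two_K2_K1 G"
    using assms(2-) unfolding induced_embedding_def two_K2_K1_simps
    by auto
  then show ?thesis by blast
qed

lemma induced_embedding_D_2_4_2:
  assumes "pair_graph G" "\<nexists>xs. vertex_cycle (parcs G) xs"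
    and "distinct [p, q, r, s, a, b, c, d]"
    and "(p, q) \<in> parcs G" "(q, r) \<in> parcs G" "(r, s) \<in> parcs G"
      "(p, a) \<in> parcs G" "(p, b) \<in> parcs G" "(s, c) \<in> parcs G" "(s, d) \<in> parcs G"
  shows "\<exists>f. induced_embedding f (D_graph 2 4 2) G"
proof -
  have sym: "sym (parcs G)" and irrefl: "(u, u) \<notin> parcs G"
    and ends: "(u, v) \<in> parcs G \<Longrightarrow> u \<in> pverts G \<and> v \<in> pverts G" for u v
    using assms(1) by (auto simp: pair_graph_iff irrefl_def)
  note edges = assms(4-) assms(4-)[THEN symD[OF sym]]
  \<comment> \<open>Any two vertices of the copy lie together on one of these four paths or of the
    two in \<open>leaves\<close>, so non-adjacency is settled for all pairs.\<close>
  have chord: "chordless (parcs G) [x, p, q, r, s, y]" if "x \<in> {a, b}" "y \<in> {c, d}" for x y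
    using that assms(3) edges by (intro acyclic_path_chordless[OF assms(2) sym]) auto
  have leaves: "chordless (parcs G) [a, p, b]" "chordless (parcs G) [c, s, d]"
    using assms(3) edges by (intro acyclic_path_chordless[OF assms(2) sym]; auto)+
  have "induced_embedding ((!) [p, q, r, s, a, b, c, d]) (D_graph 2 4 2) G"
    unfolding induced_embedding_def D_2_4_2_simps
    using edges leaves irrefl chord[of a c] chord[of a d] chord[of b c] chord[of b d]
      edges[THEN ends] assms(3)
    by simp
  then show ?thesis by blast
qed

theorem proposition5:
  fixes T :: "'a pair_pre_digraph"
  assumes "tree_graph T"
  shows "acyclic_graph (TS 3 T) \<longleftrightarrow>
    free_of T {disjoint_union (disjoint_union (complete_graph 2) (complete_graph 2)) (complete_graph 1),
               D_graph 2 4 2}"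
proof -
  have T: "pair_graph T" and conn: "Digraph_Component.connected (with_proj T)"
    and acyc: "\<nexists>xs. vertex_cycle (parcs T) xs"
    using assms acyclic_graph_iff by (auto simp: tree_graph_def)
  interpret pair_graph T by fact
  have TS: "pair_graph (TS 3 T)"
    using T by (rule pair_graph_TS)
  have H: "pair_graph two_K2_K1" "pair_graph (D_graph 2 4 2)"
    by (intro pair_graph_disjoint_union pair_graph_complete_graph pair_graph_D_graph; simp)+
  have free: "free_of T {two_K2_K1, D_graph 2 4 2} \<longleftrightarrow>
      (\<nexists>f. induced_embedding f two_K2_K1 T) \<and> (\<nexists>f. induced_embedding f (D_graph 2 4 2) T)"
    using contains_induced_iff[OF T H(1)] contains_induced_iff[OF T H(2)] by (simp add: free_of_def)
  show ?thesis
  proof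
    assume "acyclic_graph (TS 3 T)"
    then show "free_of T {two_K2_K1, D_graph 2 4 2}"
      unfolding free acyclic_graph_iff[OF TS]
      using vertex_cycle_TS_induced_embedding[OF _ H(1) vertex_cycle_TS_two_K2_K1]
        vertex_cycle_TS_induced_embedding[OF _ H(2) vertex_cycle_TS_D_2_4_2]
      by blast
  next
    assume "free_of T {two_K2_K1, D_graph 2 4 2}"
    then have no_emb: "\<nexists>f. induced_embedding f two_K2_K1 T"
      "\<nexists>f. induced_embedding f (D_graph 2 4 2) T"
      unfolding free by auto
    interpret forbidden_free_tree "pverts T" "parcs T"
    proof
      show "parcs T \<subseteq> pverts T \<times> pverts T" "sym (parcs T)" "irrefl (parcs T)"
        using T by (auto simp: pair_graph_iff)
      show "\<nexists>xs. vertex_cycle (parcs T) xs" by fact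
      show "(u, v) \<in> (parcs T)\<^sup>*" if "u \<in> pverts T" "v \<in> pverts T" for u v
      proof -
        \<comment> \<open>Library connectedness refers to the symmetric closure, which has the same
          reachability here since the arcs are already symmetric.\<close>
        have "u \<rightarrow>\<^sup>*\<^bsub>with_proj (mk_symmetric (with_proj T))\<^esub> v"
          using conn that by (simp add: connected_def strongly_connected_def)
        then have "u \<rightarrow>\<^sup>*\<^bsub>with_proj T\<^esub> v"
          unfolding reachable_mk_symmetric_eq[OF sym_arcs] .
        moreover have "arcs_ends (with_proj T) = parcs T"
          by (auto simp: arcs_ends_conv)
        ultimately show ?thesis
          using reachable_rtranclI by metis
      qed
    next
      fix a b c d e
      assume "(a, b) \<in> parcs T" "(c, d) \<in> parcs T" "e \<in> pverts T"
        "(a, c) \<notin> parcs T" "(a, d) \<notin> parcs T" "(b, c) \<notin> parcs T" "(b, d) \<notin> parcs T"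
        "(e, a) \<notin> parcs T" "(e, b) \<notin> parcs T" "(e, c) \<notin> parcs T" "(e, d) \<notin> parcs T"
      then have "\<exists>f. induced_embedding f two_K2_K1 T"
        by (intro induced_embedding_two_K2_K1[OF T, of a b c d e]) auto
      with no_emb show False by simp
    next
      fix p q r s a b c d
      assume "distinct [p, q, r, s, a, b, c, d]"
        "(p, q) \<in> parcs T" "(q, r) \<in> parcs T" "(r, s) \<in> parcs T"
        "(p, a) \<in> parcs T" "(p, b) \<in> parcs T" "(s, c) \<in> parcs T" "(s, d) \<in> parcs T"
      from induced_embedding_D_2_4_2[OF T acyc this] no_emb show False by simp
    qed
    show "acyclic_graph (TS 3 T)"
      unfolding acyclic_graph_iff[OF TS]
    proof
      assume "\<exists>xs. vertex_cycle (parcs (TS 3 T)) xs"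
      then obtain xs where xs: "vertex_cycle (parcs (TS 3 T)) xs" ..
      have symTS: "sym (parcs (TS 3 T))" using TS by (simp add: pair_graph_iff)
      interpret token_cycle "pverts T" "parcs T" "set xs"
      proof
        fix I J assume I: "I \<in> set xs"
        \<comment> \<open>A neighbour on the cycle other than \<open>J\<close> supplies
          \<open>move\<close>; being the tail of an arc also makes \<open>I\<close> an independent
          set of size three.\<close>
        obtain K where K: "K \<in> set xs" "K \<noteq> J" "(I, K) \<in> parcs (TS 3 T)"
          using vertex_cycle_other_neighbour[OF xs symTS I] by blast
        then show "\<exists>K\<in>set xs. K \<noteq> J \<and> (\<exists>u v. I - K = {u} \<and> K - I = {v} \<and> (u, v) \<in> parcs T)"
          using TS_slideD[OF K(3)] by (intro bexI[of _ K] conjI)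
        show "I \<subseteq> pverts T \<and> card I = 3 \<and> (\<forall>u\<in>I. \<forall>v\<in>I. (u, v) \<notin> parcs T)"
          using K(3) by (simp add: TS_def independent_set_def)
      qed
      have "\<exists>ys. vertex_cycle (parcs T) ys"
      proof (rule vertex_cycle_single_token[OF xs symTS TS_slideD])
        fix I J J' assume IJ: "I \<in> set xs" "J \<in> set xs" "J' \<in> set xs"
          and arcs: "(I, J) \<in> parcs (TS 3 T)" "(I, J') \<in> parcs (TS 3 T)"
        obtain u v where uv: "I - J = {u}" "J - I = {v}" "(u, v) \<in> parcs T"
          using TS_slideD[OF arcs(1)] by auto
        obtain u' v' where uv': "I - J' = {u'}" "J' - I = {v'}" "(u', v') \<in> parcs T"
          using TS_slideD[OF arcs(2)] by auto
        show "I - J = I - J'"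
          using same_token_moves[OF IJ uv uv'] uv(1) uv'(1) by simp
      qed
      then show False using acyc by simp
    qed
  qed
qed

end
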